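(* A PCTL formula $\Phi$ is an absolute liveness property iff $\Phi\not\equiv\bot$ and $\Phi\equiv\mathbb{P}_{>0}(\Diamond\Phi)$.
   Context: Fix a finite non-empty set $\mathit{AP}$. A probabilistic tree (PT) is $T=(W,L,P)$ with $\epsilon\notin W$, $W\cup\{\epsilon\}\subseteq\mathbb{N}^*$ prefix-closed, $L:W\to\mathcal{P}(\mathit{AP})$, and $P$ a partial function from $W$ to distributions over $W$ with $P(\pi)(\pi')>0$ iff $\pi'=\pi\cdot n\in W$ for some $n$. $T$ is total if every node is a proper prefix of some node; $\mathbb{T}^\omega$ is the set of total PTs; a property is a subset of $\mathbb{T}^\omega$. Suffix: $T_2$ is a suffix of $T_1$ iff there is $\pi_1\in W_1$ with $\{\pi_1\cdot\pi_2\mid\pi_2\in W_2\}\subseteq W_1$, $L_2(\pi_2)=L_1(\pi_1\cdot\pi_2)$ for all $\pi_2\in W_2$, and $P_2(\pi_2,\pi'_2)=P_1(\pi_1\cdot\pi_2,\pi_1\cdot\pi'_2)$ for all $\pi_2,\pi'_2\in W_2$. $P$ is an absolute liveness property iff $P\ne\emptyset$ and for all $T,T'\in\mathbb{T}^\omega$: if $T'\in P$ and $T'$ is a suffix of $T$ then $T\in P$. A Markov chain (MC) is $\mathsf{D}=(S,\mathit{AP},\to,L,s_0)$ with $S\subseteq\mathbb{N}$ countable, $\to:S\to\mathit{Dist}(S)$ total, $L:S\to\mathcal{P}(\mathit{AP})$, initial state $s_0$. Its unfolding $T(\mathsf{D})$ has as nodes the least set of state sequences containing $s_0$ and closed under appending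 a state $t$ with $\mu(t)>0$ where $\mathrm{last}(\pi)\to\mu$; labels $L(\mathrm{last}(\pi))$; edge probabilities $P(\pi,\pi')=\mu(\mathrm{last}(\pi'))$ with $\mathrm{last}(\pi)\to\mu$. PCTL: state formulas $\Phi::=a\mid\Phi_1\land\Phi_2\mid\neg\Phi\mid\mathbb{P}_{\bowtie q}(\varphi)$, path formulas $\varphi::=\mathsf{X}\Phi\mid\Phi_1\mathsf{U}\Phi_2\mid\Phi_1\mathsf{W}\Phi_2$, $\bowtie\in\{<,>,\le,\ge\}$, $q\in[0,1]$, standard semantics on MCs; $\top=a\lor\neg a$, $\bot=\neg\top$, $\Diamond\Phi=\top\mathsf{U}\Phi$. $P_\Phi=\{T(\mathsf{D})\mid\mathsf{D}\models\Phi\}$ ($\mathsf{D}\models\Phi$ iff the initial state satisfies $\Phi$); $\Phi$ is an absolute liveness property iff $P_\Phi$ is; $\Phi\equiv\Psi$ iff $P_\Phi=P_\Psi$.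
   Formalization: The property of a formula is taken to be all total trees isomorphic to an unfolding T(D) with D satisfying it, and a probabilistic tree has at most one root; with literal unfoldings or with forests the claim already fails for the formula ⊤. *)

theory Defs
  imports "HOL-Probability.Probability" "HOL-Library.Sublist"
begin

text \<open>
  The finite non-empty set of atomic propositions is a type \<open>'ap\<close> of class \<open>finite\<close>
  (imposed in the theorem; no definition depends on it).
\<close>

section \<open>Probabilistic trees\<close>

record 'ap pt =
  nodes :: "nat list set"
  node_label :: "nat list \<rightharpoonup> 'ap set"
  node_dist :: "nat list \<rightharpoonup> nat list pmf"

text \<open>An undefined distribution contributes edge probability 0.\<close>

definition edge_prob :: "'ap pt \<Rightarrow> nat list \<Rightarrow> nat list \<Rightarrow> real" where
  "edge_prob T \<pi> \<pi>' = (case node_dist T \<pi> of None \<Rightarrow> 0 | Some \<mu> \<Rightarrow> pmf \<mu> \<pi>')"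

text \<open>
  Since the empty word is not a node, the nodes of length 1 are the roots; a tree, as opposed to a
  forest, has at most one of them.
\<close>

definition is_pt :: "'ap pt \<Rightarrow> bool" where
  "is_pt T \<longleftrightarrow>
     [] \<notin> nodes T \<and>
     (\<forall>\<pi> \<pi>'. \<pi>' \<in> nodes T \<union> {[]} \<and> prefix \<pi> \<pi>' \<longrightarrow> \<pi> \<in> nodes T \<union> {[]}) \<and>
     (\<forall>m n. [m] \<in> nodes T \<and> [n] \<in> nodes T \<longrightarrow> m = n) \<and>
     dom (node_label T) = nodes T \<and>
     dom (node_dist T) \<subseteq> nodes T \<and>
     (\<forall>\<pi>\<in>nodes T. \<forall>\<pi>'. edge_prob T \<pi> \<pi>' > 0 \<longleftrightarrow> (\<exists>n. \<pi>' = \<pi> @ [n] \<and> \<pi>' \<in> nodes T))"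

definition total_pts :: "'ap pt set" where
  "total_pts = {T. is_pt T \<and> (\<forall>\<pi>\<in>nodes T. \<exists>\<pi>'\<in>nodes T. strict_prefix \<pi> \<pi>')}"

definition suffix_pt :: "'ap pt \<Rightarrow> 'ap pt \<Rightarrow> bool" where
  "suffix_pt T2 T1 \<longleftrightarrow> (\<exists>\<pi>1\<in>nodes T1.
     {\<pi>1 @ \<pi>2 | \<pi>2. \<pi>2 \<in> nodes T2} \<subseteq> nodes T1 \<and>
     (\<forall>\<pi>2\<in>nodes T2. node_label T2 \<pi>2 = node_label T1 (\<pi>1 @ \<pi>2)) \<and>
     (\<forall>\<pi>2\<in>nodes T2. \<forall>\<pi>2'\<in>nodes T2.
        edge_prob T2 \<pi>2 \<pi>2' = edge_prob T1 (\<pi>1 @ \<pi>2) (\<pi>1 @ \<pi>2')))"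

definition absolute_liveness :: "'ap pt set \<Rightarrow> bool" where
  "absolute_liveness P \<longleftrightarrow> P \<noteq> {} \<and>
     (\<forall>T\<in>total_pts. \<forall>T'\<in>total_pts. T' \<in> P \<and> suffix_pt T' T \<longrightarrow> T \<in> P)"

text \<open>Isomorphism: renaming of the numbers used as branch directions.\<close>

definition pt_iso :: "'ap pt \<Rightarrow> 'ap pt \<Rightarrow> bool" where
  "pt_iso T1 T2 \<longleftrightarrow> (\<exists>f. bij_betw f (nodes T1) (nodes T2) \<and>
     (\<forall>\<pi>\<in>nodes T1. \<forall>\<pi>'\<in>nodes T1. prefix \<pi> \<pi>' \<longleftrightarrow> prefix (f \<pi>) (f \<pi>')) \<and>
     (\<forall>\<pi>\<in>nodes T1. node_label T2 (f \<pi>) = node_label T1 \<pi>) \<and>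
     (\<forall>\<pi>\<in>nodes T1. \<forall>\<pi>'\<in>nodes T1. edge_prob T2 (f \<pi>) (f \<pi>') = edge_prob T1 \<pi> \<pi>'))"


section \<open>Markov chains\<close>

record 'ap mc =
  states :: "nat set"
  trans_dist :: "nat \<Rightarrow> nat pmf"
  state_label :: "nat \<Rightarrow> 'ap set"
  init :: nat

text \<open>Values of \<open>trans_dist\<close> and \<open>state_label\<close> outside \<open>states\<close> are irrelevant.\<close>

definition is_mc :: "'ap mc \<Rightarrow> bool" where
  "is_mc D \<longleftrightarrow> init D \<in> states D \<and> (\<forall>s\<in>states D. set_pmf (trans_dist D s) \<subseteq> states D)"

inductive_set unfolding_nodes :: "'ap mc \<Rightarrow> nat list set" for D :: "'ap mc" where
  root: "[init D] \<in> unfolding_nodes D"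
| step: "\<pi> \<in> unfolding_nodes D \<Longrightarrow> pmf (trans_dist D (last \<pi>)) t > 0 \<Longrightarrow> \<pi> @ [t] \<in> unfolding_nodes D"

definition unfolding_pt :: "'ap mc \<Rightarrow> 'ap pt" where
  "unfolding_pt D = \<lparr>
     nodes = unfolding_nodes D,
     node_label = (\<lambda>\<pi>. if \<pi> \<in> unfolding_nodes D then Some (state_label D (last \<pi>)) else None),
     node_dist = (\<lambda>\<pi>. if \<pi> \<in> unfolding_nodes D
                       then Some (map_pmf (\<lambda>t. \<pi> @ [t]) (trans_dist D (last \<pi>))) else None)\<rparr>"

lemma edge_prob_unfolding_child:
  assumes "\<pi> \<in> unfolding_nodes D"
  shows "edge_prob (unfolding_pt D) \<pi> (\<pi> @ [t]) = pmf (trans_dist D (last \<pi>)) t"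
  using assms pmf_map_inj'[of "\<lambda>t. \<pi> @ [t]" "trans_dist D (last \<pi>)" t]
  by (simp add: edge_prob_def unfolding_pt_def inj_def)

lemma edge_prob_unfolding_pos:
  assumes "\<pi> \<in> unfolding_nodes D"
  shows "edge_prob (unfolding_pt D) \<pi> \<pi>' > 0 \<longleftrightarrow> (\<exists>t. \<pi>' = \<pi> @ [t] \<and> \<pi>' \<in> unfolding_nodes D)"
proof
  assume "edge_prob (unfolding_pt D) \<pi> \<pi>' > 0"
  then have "\<pi>' \<in> set_pmf (map_pmf (\<lambda>t. \<pi> @ [t]) (trans_dist D (last \<pi>)))"
    using assms by (simp add: edge_prob_def unfolding_pt_def pmf_positive_iff del: set_map_pmf)
  then show "\<exists>t. \<pi>' = \<pi> @ [t] \<and> \<pi>' \<in> unfolding_nodes D"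
    using assms by (auto intro!: unfolding_nodes.step simp: pmf_positive)
next
  assume "\<exists>t. \<pi>' = \<pi> @ [t] \<and> \<pi>' \<in> unfolding_nodes D"
  then obtain t where t: "\<pi>' = \<pi> @ [t]" "\<pi> @ [t] \<in> unfolding_nodes D" by blast
  have "\<pi> \<noteq> []" using assms by (auto elim: unfolding_nodes.cases)
  with t(2) have "pmf (trans_dist D (last \<pi>)) t > 0"
    by (cases rule: unfolding_nodes.cases) auto
  then show "edge_prob (unfolding_pt D) \<pi> \<pi>' > 0"
    using assms t by (simp add: edge_prob_unfolding_child)
qed

lemma unfolding_nodes_prefix:
  "\<pi>' \<in> unfolding_nodes D \<Longrightarrow> prefix \<pi> \<pi>' \<Longrightarrow> \<pi> = [] \<or> \<pi> \<in> unfolding_nodes D"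
proof (induction rule: unfolding_nodes.induct)
  case root
  then show ?case by (auto simp: prefix_Cons intro: unfolding_nodes.root)
next
  case (step \<pi>' t)
  then show ?case by (auto intro: unfolding_nodes.step)
qed

lemma hd_unfolding_nodes: "\<pi> \<in> unfolding_nodes D \<Longrightarrow> \<pi> \<noteq> [] \<and> hd \<pi> = init D"
  by (induction rule: unfolding_nodes.induct) auto

lemma unfolding_total_pt: "unfolding_pt D \<in> total_pts"
proof -
  have n: "nodes (unfolding_pt D) = unfolding_nodes D" by (simp add: unfolding_pt_def)
  have "is_pt (unfolding_pt D)"
    unfolding is_pt_def n
  proof (intro conjI allI impI ballI)
    show "[] \<notin> unfolding_nodes D" by (auto dest: hd_unfolding_nodes)
    show "\<pi> \<in> unfolding_nodes D \<union> {[]}"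
      if "\<pi>' \<in> unfolding_nodes D \<union> {[]} \<and> prefix \<pi> \<pi>'" for \<pi> \<pi>'
      using that unfolding_nodes_prefix by auto
    show "a = b" if "[a] \<in> unfolding_nodes D \<and> [b] \<in> unfolding_nodes D" for a b
      using that by (auto dest!: hd_unfolding_nodes)
    show "dom (node_label (unfolding_pt D)) = unfolding_nodes D"
      "dom (node_dist (unfolding_pt D)) \<subseteq> unfolding_nodes D"
      by (auto simp: unfolding_pt_def dom_def)
  qed (rule edge_prob_unfolding_pos)
  moreover have "\<exists>\<pi>'\<in>unfolding_nodes D. strict_prefix \<pi> \<pi>'" if "\<pi> \<in> unfolding_nodes D" for \<pi>
  proof -
    obtain t where "t \<in> set_pmf (trans_dist D (last \<pi>))" using set_pmf_not_empty by fastforce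
    then have "\<pi> @ [t] \<in> unfolding_nodes D"
      using that by (auto intro: unfolding_nodes.step simp: pmf_positive)
    then show ?thesis by (intro bexI[of _ "\<pi> @ [t]"]) (auto simp: strict_prefix_def)
  qed
  ultimately show ?thesis by (simp add: total_pts_def n)
qed


section \<open>The probability measure on paths\<close>

text \<open>
  At every step a successor is drawn independently for all states at once; the walk uses the one
  drawn for its current state. The resulting law on paths is characterised by the measure of the
  cylinder sets (lemmas \<open>emeasure_path_measure_cylinder\<close> and \<open>path_measure_unique\<close>).
\<close>

primcorec walk :: "nat \<Rightarrow> (nat \<Rightarrow> nat) stream \<Rightarrow> nat stream" where
  "walk s \<omega> = s ## walk (shd \<omega> s) (stl \<omega>)"

definition path_measure :: "(nat \<Rightarrow> nat pmf) \<Rightarrow> nat \<Rightarrow> nat stream measure" where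
  "path_measure K s =
     distr (stream_space (\<Pi>\<^sub>M t\<in>UNIV. measure_pmf (K t))) (stream_space (count_space UNIV)) (walk s)"

lemma space_path_measure [simp]: "space (path_measure K s) = UNIV"
  by (simp add: path_measure_def space_stream_space)

lemma sets_path_measure [simp, measurable_cong]:
  "sets (path_measure K s) = sets (stream_space (count_space UNIV))"
  by (simp add: path_measure_def)

lemma measurable_walk [measurable]:
  "walk s \<in> stream_space (\<Pi>\<^sub>M t\<in>UNIV. measure_pmf (K t)) \<rightarrow>\<^sub>M stream_space (count_space UNIV)"
proof -
  let ?M = "stream_space (\<Pi>\<^sub>M t\<in>UNIV. measure_pmf (K t))"
  have "(\<lambda>\<omega>. walk (g \<omega>) (h \<omega>)) \<in> N \<rightarrow>\<^sub>M stream_space (count_space UNIV)"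
    if "g \<in> N \<rightarrow>\<^sub>M count_space UNIV" "h \<in> N \<rightarrow>\<^sub>M ?M" for g :: "_ \<Rightarrow> nat" and h and N :: "'x measure"
  proof (rule measurable_stream_space2)
    show "(\<lambda>\<omega>. walk (g \<omega>) (h \<omega>) !! n) \<in> N \<rightarrow>\<^sub>M count_space UNIV" for n
      using that
    proof (induction n arbitrary: g h)
      case 0 then show ?case by simp
    next
      case (Suc n)
      note [measurable] = Suc.prems
      have c: "(\<lambda>\<omega>. shd (h \<omega>) t) \<in> N \<rightarrow>\<^sub>M count_space UNIV" for t
      proof -
        have "(\<lambda>\<omega>. shd (h \<omega>)) \<in> N \<rightarrow>\<^sub>M (\<Pi>\<^sub>M t\<in>UNIV. measure_pmf (K t))" by measurable
        then have "(\<lambda>\<omega>. shd (h \<omega>) t) \<in> N \<rightarrow>\<^sub>M measure_pmf (K t)"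
          by (rule measurable_compose[OF _ measurable_component_singleton]) simp
        then show ?thesis by simp
      qed
      have 1: "(\<lambda>\<omega>. shd (h \<omega>) (g \<omega>)) \<in> N \<rightarrow>\<^sub>M count_space UNIV"
        using measurable_compose_countable[where f="\<lambda>t \<omega>. shd (h \<omega>) t", OF c Suc.prems(1)] .
      have 2: "(\<lambda>\<omega>. stl (h \<omega>)) \<in> N \<rightarrow>\<^sub>M ?M" by measurable
      from Suc.IH[OF 1 2] show ?case by simp
    qed
  qed
  from this[of "\<lambda>_. s" _ "\<lambda>\<omega>. \<omega>"] show ?thesis by simp
qed

lemma prob_space_path_measure: "prob_space (path_measure K s)"
  unfolding path_measure_def
  by (intro prob_space.prob_space_distr prob_space.prob_space_stream_space prob_space_PiM
      prob_space_measure_pmf measurable_walk)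

lemma emeasure_path_measure_step:
  assumes X: "X \<in> sets (stream_space (count_space UNIV))"
  shows "emeasure (path_measure K s) X =
    (\<integral>\<^sup>+t. emeasure (path_measure K t) {\<omega>. s ## \<omega> \<in> X} \<partial>measure_pmf (K s))"
proof -
  let ?P = "\<Pi>\<^sub>M t\<in>UNIV. measure_pmf (K t)"
  interpret P: prob_space ?P by (intro prob_space_PiM prob_space_measure_pmf)
  interpret PP: product_prob_space "\<lambda>t. measure_pmf (K t)" UNIV by standard
  have sp: "space (stream_space ?P) = UNIV"
    by (simp add: space_stream_space space_PiM)
  have S: "walk s -` X \<in> sets (stream_space ?P)"
    using measurable_sets[OF measurable_walk X, of s K] by (simp add: sp)
  have X': "{\<omega>. s ## \<omega> \<in> X} \<in> sets (stream_space (count_space UNIV))"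
  proof -
    have "(\<lambda>\<omega>. s ## \<omega>) \<in> stream_space (count_space UNIV) \<rightarrow>\<^sub>M stream_space (count_space UNIV)"
      by measurable
    from measurable_sets[OF this X] show ?thesis by (simp add: space_stream_space vimage_def)
  qed
  have *: "emeasure (stream_space ?P) {\<omega>. t ## \<omega> \<in> walk s -` X} =
      emeasure (path_measure K (t s)) {\<omega>. s ## \<omega> \<in> X}" for t
    unfolding path_measure_def
    by (subst emeasure_distr[OF measurable_walk X'])
       (auto simp: sp walk.code[of s "_ ## _"] intro!: arg_cong2[where f=emeasure])
  have "emeasure (path_measure K s) X = emeasure (stream_space ?P) (walk s -` X)"
    by (simp add: path_measure_def emeasure_distr[OF measurable_walk X] sp)
  also have "\<dots> = (\<integral>\<^sup>+t. emeasure (path_measure K (t s)) {\<omega>. s ## \<omega> \<in> X} \<partial>?P)"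
    by (subst P.emeasure_stream_space[OF S]) (simp add: sp *[simplified vimage_eq mem_Collect_eq])
  also have "\<dots> = (\<integral>\<^sup>+t. emeasure (path_measure K t) {\<omega>. s ## \<omega> \<in> X} \<partial>distr ?P (measure_pmf (K s)) (\<lambda>t. t s))"
    by (subst nn_integral_distr) auto
  also have "distr ?P (measure_pmf (K s)) (\<lambda>t. t s) = measure_pmf (K s)"
    using PP.PiM_component[of s] by simp
  finally show ?thesis .
qed

lemma emeasure_path_measure_cylinder:
  "emeasure (path_measure K s) {\<omega>. stake (Suc (length \<pi>)) \<omega> = s # \<pi>} =
     ennreal (\<Prod>i<length \<pi>. pmf (K ((s # \<pi>) ! i)) (\<pi> ! i))"
proof (induction \<pi> arbitrary: s)
  have m: "{\<omega>. stake n \<omega> = \<pi>} \<in> sets (stream_space (count_space UNIV))" for n and \<pi> :: "nat list"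
    using measurable_sets[OF measurable_stake, of "{\<pi>}" n] by (simp add: space_stream_space vimage_def)
  {
    case Nil
    interpret prob_space "path_measure K t" for t by (rule prob_space_path_measure)
    from emeasure_space_1 show ?case
      by (subst emeasure_path_measure_step[OF m]) (simp add: measure_pmf.emeasure_space_1)
  next
    case (Cons t \<pi>)
    have 0: "emeasure (path_measure K u) {\<omega>. stake (Suc (length \<pi>)) \<omega> = t # \<pi>} = 0" if "u \<noteq> t" for u
      by (subst emeasure_path_measure_step) (use that in \<open>simp_all add: m del: stake.simps(2), simp\<close>)
    let ?c = "emeasure (path_measure K t) {\<omega>. stake (Suc (length \<pi>)) \<omega> = t # \<pi>}"
    have "emeasure (path_measure K s) {\<omega>. stake (Suc (length (t # \<pi>))) \<omega> = s # t # \<pi>} =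
      (\<integral>\<^sup>+u. emeasure (path_measure K u) {\<omega>. stake (Suc (length \<pi>)) \<omega> = t # \<pi>} \<partial>measure_pmf (K s))"
      by (subst emeasure_path_measure_step[OF m]) simp
    also have "\<dots> = (\<integral>\<^sup>+u. ?c * indicator {t} u \<partial>measure_pmf (K s))"
      by (intro nn_integral_cong) (auto simp: 0 split: split_indicator simp del: stake.simps)
    also have "\<dots> = ?c * emeasure (measure_pmf (K s)) {t}"
      by (simp add: nn_integral_cmult_indicator del: stake.simps)
    also have "\<dots> = ennreal (pmf (K s) t * (\<Prod>i<length \<pi>. pmf (K ((t # \<pi>) ! i)) (\<pi> ! i)))"
      by (simp add: Cons.IH emeasure_pmf_single ennreal_mult prod_nonneg mult.commute del: stake.simps)
    also have "pmf (K s) t * (\<Prod>i<length \<pi>. pmf (K ((t # \<pi>) ! i)) (\<pi> ! i)) =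
      (\<Prod>i<length (t # \<pi>). pmf (K ((s # t # \<pi>) ! i)) ((t # \<pi>) ! i))"
      by (simp only: length_Cons prod.lessThan_Suc_shift) simp
    finally show ?case .
  }
qed

lemma path_measure_unique:
  assumes "prob_space M" and sets: "sets M = sets (stream_space (count_space UNIV))"
    and cyl: "\<And>\<pi>. emeasure M {\<omega>. stake (Suc (length \<pi>)) \<omega> = s # \<pi>} =
      ennreal (\<Prod>i<length \<pi>. pmf (K ((s # \<pi>) ! i)) (\<pi> ! i))"
  shows "M = path_measure K s"
proof (rule stream_space_eq_sstart[where S=UNIV])
  interpret M: prob_space M by fact
  have m: "{\<omega>. stake n \<omega> = \<pi>} \<in> sets (stream_space (count_space UNIV))" for n and \<pi> :: "nat list"
    using measurable_sets[OF measurable_stake, of "{\<pi>}" n] by (simp add: space_stream_space vimage_def)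
  have st: "sstart UNIV xs = {\<omega>. stake (length xs) \<omega> = xs}" for xs :: "nat list"
  proof -
    have "\<omega> \<in> sstart UNIV xs \<longleftrightarrow> stake (length xs) \<omega> = xs" for \<omega>
      by (induction xs arbitrary: \<omega>) (simp_all del: sstart.simps(2))
    then show ?thesis by blast
  qed
  show "emeasure M (sstart UNIV xs) = emeasure (path_measure K s) (sstart UNIV xs)"
    if ne: "xs \<noteq> []" for xs
  proof -
    obtain t \<pi> where xs: "xs = t # \<pi>" using ne by (cases xs) auto
    show ?thesis
    proof (cases "t = s")
      case True
      then show ?thesis
        using cyl[of \<pi>] emeasure_path_measure_cylinder[of K s \<pi>] by (simp add: st xs del: stake.simps)
    next
      case False
      have z: "emeasure N {\<omega>. stake (length xs) \<omega> = xs} = 0"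
        if N: "prob_space N" "sets N = sets (stream_space (count_space UNIV))"
          and o: "emeasure N {\<omega>. stake (Suc 0) \<omega> = [s]} = 1" for N
      proof -
        interpret N: prob_space N by fact
        have "AE \<omega> in N. \<omega> \<in> {\<omega>. stake (Suc 0) \<omega> = [s]}"
          using o by (intro N.AE_prob_1) (simp add: N.emeasure_eq_measure)
        then have "AE \<omega> in N. \<not> stake (length xs) \<omega> = xs"
          by eventually_elim (use False xs in auto)
        then show ?thesis
          using m[of "length xs" xs] N(2) sets_eq_imp_space_eq[OF N(2)]
          by (subst (asm) AE_iff_measurable[OF _ refl]) (simp_all add: space_stream_space)
      qed
      have "emeasure M {\<omega>. stake (length xs) \<omega> = xs} = 0"
        by (rule z) (use cyl[of "[]"] sets in \<open>simp_all add: M.prob_space_axioms\<close>)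
      moreover have "emeasure (path_measure K s) {\<omega>. stake (length xs) \<omega> = xs} = 0"
        by (rule z) (use emeasure_path_measure_cylinder[of K s "[]"] in \<open>simp_all add: prob_space_path_measure\<close>)
      ultimately show ?thesis by (simp add: st)
    qed
  qed
qed (auto simp: sets assms prob_space_path_measure)


section \<open>PCTL\<close>

datatype cmp = Less | Greater | LessEq | GreaterEq

primrec cmp_rel :: "cmp \<Rightarrow> real \<Rightarrow> real \<Rightarrow> bool" where
  "cmp_rel Less x q \<longleftrightarrow> x < q"
| "cmp_rel Greater x q \<longleftrightarrow> x > q"
| "cmp_rel LessEq x q \<longleftrightarrow> x \<le> q"
| "cmp_rel GreaterEq x q \<longleftrightarrow> x \<ge> q"

datatype 'ap state_formula =
    Atom 'ap
  | Conj "'ap state_formula" "'ap state_formula"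
  | Neg "'ap state_formula"
  | Prob cmp real "'ap path_formula"
and 'ap path_formula =
    Next "'ap state_formula"
  | Until "'ap state_formula" "'ap state_formula"
  | WeakUntil "'ap state_formula" "'ap state_formula"

primrec wf_state :: "'ap state_formula \<Rightarrow> bool"
  and wf_path :: "'ap path_formula \<Rightarrow> bool" where
  "wf_state (Atom a) \<longleftrightarrow> True"
| "wf_state (Conj \<Phi> \<Psi>) \<longleftrightarrow> wf_state \<Phi> \<and> wf_state \<Psi>"
| "wf_state (Neg \<Phi>) \<longleftrightarrow> wf_state \<Phi>"
| "wf_state (Prob c q \<phi>) \<longleftrightarrow> q \<in> {0..1} \<and> wf_path \<phi>"
| "wf_path (Next \<Phi>) \<longleftrightarrow> wf_state \<Phi>"
| "wf_path (Until \<Phi> \<Psi>) \<longleftrightarrow> wf_state \<Phi> \<and> wf_state \<Psi>"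
| "wf_path (WeakUntil \<Phi> \<Psi>) \<longleftrightarrow> wf_state \<Phi> \<and> wf_state \<Psi>"

primrec sat :: "'ap state_formula \<Rightarrow> 'ap mc \<Rightarrow> nat \<Rightarrow> bool"
  and path_sat :: "'ap path_formula \<Rightarrow> 'ap mc \<Rightarrow> nat stream \<Rightarrow> bool" where
  "sat (Atom a) D s \<longleftrightarrow> a \<in> state_label D s"
| "sat (Conj \<Phi> \<Psi>) D s \<longleftrightarrow> sat \<Phi> D s \<and> sat \<Psi> D s"
| "sat (Neg \<Phi>) D s \<longleftrightarrow> \<not> sat \<Phi> D s"
| "sat (Prob c q \<phi>) D s \<longleftrightarrow>
     cmp_rel c (measure (path_measure (trans_dist D) s) {\<omega>. path_sat \<phi> D \<omega>}) q"
| "path_sat (Next \<Phi>) D \<omega> \<longleftrightarrow> sat \<Phi> D (\<omega> !! 1)"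
| "path_sat (Until \<Phi> \<Psi>) D \<omega> \<longleftrightarrow> (\<exists>j. sat \<Psi> D (\<omega> !! j) \<and> (\<forall>k<j. sat \<Phi> D (\<omega> !! k)))"
| "path_sat (WeakUntil \<Phi> \<Psi>) D \<omega> \<longleftrightarrow>
     (\<exists>j. sat \<Psi> D (\<omega> !! j) \<and> (\<forall>k<j. sat \<Phi> D (\<omega> !! k))) \<or> (\<forall>k. sat \<Phi> D (\<omega> !! k))"

text \<open>The events measured in the semantics of \<open>Prob\<close> are measurable.\<close>

lemma path_sat_measurable: "{\<omega>. path_sat \<phi> D \<omega>} \<in> sets (path_measure K s)"
proof -
  have "Measurable.pred (stream_space (count_space UNIV)) (path_sat \<phi> D)"
    by (cases \<phi>) (simp_all add: path_sat.simps[abs_def])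
  then show ?thesis by (simp add: pred_def space_stream_space)
qed

definition mc_sat :: "'ap mc \<Rightarrow> 'ap state_formula \<Rightarrow> bool" where
  "mc_sat D \<Phi> \<longleftrightarrow> sat \<Phi> D (init D)"

definition Disj :: "'ap state_formula \<Rightarrow> 'ap state_formula \<Rightarrow> 'ap state_formula" where
  "Disj \<Phi> \<Psi> = Neg (Conj (Neg \<Phi>) (Neg \<Psi>))"

definition Top :: "'ap state_formula" where
  "Top = (let a = (SOME a. True) in Disj (Atom a) (Neg (Atom a)))"

definition Bot :: "'ap state_formula" where
  "Bot = Neg Top"

definition Eventually :: "'ap state_formula \<Rightarrow> 'ap path_formula" where
  "Eventually \<Phi> = Until Top \<Phi>"

text \<open>
  Probabilistic trees are identified up to isomorphism, so the property of a formula consists of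
  all total trees isomorphic to the unfolding of a model. (Literal unfoldings would not do: there,
  nodes ending in the same number carry the same label, so already the property of \<open>Top\<close> would
  not be closed under adding a new root.)
\<close>

definition property_of :: "'ap state_formula \<Rightarrow> 'ap pt set" where
  "property_of \<Phi> = {T \<in> total_pts. \<exists>D. is_mc D \<and> mc_sat D \<Phi> \<and> pt_iso (unfolding_pt D) T}"

definition pctl_absolute_liveness :: "'ap state_formula \<Rightarrow> bool" where
  "pctl_absolute_liveness \<Phi> \<longleftrightarrow> absolute_liveness (property_of \<Phi>)"

definition pctl_equiv :: "'ap state_formula \<Rightarrow> 'ap state_formula \<Rightarrow> bool" where
  "pctl_equiv \<Phi> \<Psi> \<longleftrightarrow> property_of \<Phi> = property_of \<Psi>"

end

theory Submission
  imports Defs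
begin

text \<open>
  A total tree \<open>T\<close> is itself a Markov chain, with its nodes as states, and \<open>T\<close> is isomorphic to the
  unfolding of that chain. PCTL satisfaction is invariant under functional lumpings of Markov
  chains, in particular under the map sending a node of an unfolding to its last state, under tree
  isomorphisms, and under the inclusion of a suffix. Hence membership of \<open>T\<close> in the property of a
  formula can be decided on the chain of \<open>T\<close> alone, \<open>T\<close> satisfies \<open>\<P>\<^sub>>\<^sub>0(\<diamond>\<Phi>)\<close> iff some node of \<open>T\<close>
  satisfies \<open>\<Phi>\<close>, and the non-root nodes satisfying \<open>\<Phi>\<close> are the roots of the suffixes of \<open>T\<close> in the
  property of \<open>\<Phi>\<close>.
\<close>

section \<open>Path measures and lumping\<close>

text \<open>The lumping lemmas below constrain transitions only inside \<open>S\<close>, so paths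
  must be known to stay there. For a fixed position this follows by induction from the one-step
  recursion of the path measure; then countably many almost sure events are intersected.\<close>

lemma AE_path_measure_closed:
  assumes closed: "\<And>s. s \<in> S \<Longrightarrow> set_pmf (K s) \<subseteq> S" and "s \<in> S"
  shows "AE \<omega> in path_measure K s. \<forall>n. \<omega> !! n \<in> S"
proof -
  have m: "{\<omega>. \<omega> !! n \<notin> S} \<in> sets (stream_space (count_space UNIV))" for n
  proof -
    have "Measurable.pred (stream_space (count_space UNIV)) (\<lambda>\<omega>. \<omega> !! n \<notin> S)" by measurable
    then show ?thesis by (simp add: pred_def space_stream_space)
  qed
  have "emeasure (path_measure K s) {\<omega>. \<omega> !! n \<notin> S} = 0" for n
    using \<open>s \<in> S\<close>
  proof (induction n arbitrary: s)
    case 0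
    then show ?case by (subst emeasure_path_measure_step[OF m]) simp
  next
    case (Suc n)
    have "AE t in measure_pmf (K s). emeasure (path_measure K t) {\<omega>. \<omega> !! n \<notin> S} = 0"
      using Suc closed by (auto simp: AE_measure_pmf_iff)
    then show ?case
      by (subst emeasure_path_measure_step[OF m]) (simp add: nn_integral_0_iff_AE)
  qed
  then have "AE \<omega> in path_measure K s. \<omega> !! n \<in> S" for n
    using m[of n] by (subst AE_iff_measurable[OF _ refl]) auto
  then show ?thesis by (simp add: AE_all_countable)
qed

text \<open>Probability measures on streams over a countable alphabet agree once they agree on
  cylinders. Since \<open>h\<close> may merge states, the preimage of a cylinder is only a union of
  cylinders, so the comparison peels off the first state instead of using the product
  formula.\<close>

lemma path_measure_lumping:
  assumes closed: "\<And>s. s \<in> S \<Longrightarrow> set_pmf (K s) \<subseteq> S"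
    and map: "\<And>s. s \<in> S \<Longrightarrow> K' (h s) = map_pmf h (K s)"
    and "s \<in> S"
  shows "path_measure K' (h s) = distr (path_measure K s) (stream_space (count_space UNIV)) (smap h)"
proof (rule stream_space_eq_sstart[where S=UNIV])
  have h: "smap h \<in> path_measure K s \<rightarrow>\<^sub>M stream_space (count_space UNIV)" for s
    by (rule measurable_stream_space2) simp
  have m: "{\<omega>. stake n \<omega> = \<pi>} \<in> sets (stream_space (count_space UNIV))" for n and \<pi> :: "nat list"
    using measurable_sets[OF measurable_stake, of "{\<pi>}" n] by (simp add: space_stream_space vimage_def)
  have m': "{\<omega>. map h (stake n \<omega>) = \<pi>} \<in> sets (stream_space (count_space UNIV))" for n \<pi>
    using measurable_sets[OF h m, of n \<pi>] by (simp add: vimage_def)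
  have st: "sstart UNIV xs = {\<omega>. stake (length xs) \<omega> = xs}" for xs :: "nat list"
  proof -
    have "\<omega> \<in> sstart UNIV xs \<longleftrightarrow> stake (length xs) \<omega> = xs" for \<omega>
      by (induction xs arbitrary: \<omega>) (simp_all del: sstart.simps(2))
    then show ?thesis by blast
  qed
  have eq: "emeasure (path_measure K' (h s)) {\<omega>. stake (length xs) \<omega> = xs} =
      emeasure (path_measure K s) {\<omega>. map h (stake (length xs) \<omega>) = xs}" if "s \<in> S" for xs s
    using that
  proof (induction xs arbitrary: s)
    case Nil
    interpret prob_space "path_measure K t" for K t by (rule prob_space_path_measure)
    from emeasure_space_1 show ?case by simp
  next
    case (Cons x xs)
    have "emeasure (path_measure K' (h s)) {\<omega>. stake (length (x # xs)) \<omega> = x # xs} =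
      (\<integral>\<^sup>+t. emeasure (path_measure K' (h t)) {\<omega>. h s = x \<and> stake (length xs) \<omega> = xs} \<partial>measure_pmf (K s))"
      by (subst emeasure_path_measure_step[OF m]) (simp add: map[OF Cons.prems])
    \<comment> \<open>The induction hypothesis covers successors in \<open>S\<close>, hence almost
      every \<open>t\<close>; if \<open>h s\<close> differs from \<open>x\<close>, both events are
      empty.\<close>
    also have "\<dots> = (\<integral>\<^sup>+t. emeasure (path_measure K t) {\<omega>. h s = x \<and> map h (stake (length xs) \<omega>) = xs} \<partial>measure_pmf (K s))"
      using Cons.IH closed[OF Cons.prems]
      by (intro nn_integral_cong_AE) (cases "h s = x", auto simp: AE_measure_pmf_iff)
    also have "\<dots> = emeasure (path_measure K s) {\<omega>. map h (stake (length (x # xs)) \<omega>) = x # xs}"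
      by (subst emeasure_path_measure_step[OF m', where s=s]) simp
    finally show ?case .
  qed
  show "emeasure (path_measure K' (h s)) (sstart UNIV xs) =
      emeasure (distr (path_measure K s) (stream_space (count_space UNIV)) (smap h)) (sstart UNIV xs)" for xs
    using eq[OF \<open>s \<in> S\<close>, of xs] m
    by (simp add: st emeasure_distr[OF h] vimage_def)
  show "prob_space (distr (path_measure K s) (stream_space (count_space UNIV)) (smap h))"
    by (intro prob_space.prob_space_distr prob_space_path_measure h)
qed (auto simp: prob_space_path_measure)

text \<open>The induction runs over state and path formulas at once. The substantial case is
  \<open>Prob\<close>: the path measure of \<open>D'\<close> is the image under
  \<open>smap h\<close> of that of \<open>D\<close>, and the induction hypothesis for the path
  formula applies to almost every path because these stay in \<open>S\<close>.\<close>

lemma sat_lumping: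
  fixes D D' :: "'ap mc"
  assumes closed: "\<And>s. s \<in> S \<Longrightarrow> set_pmf (trans_dist D s) \<subseteq> S"
    and map: "\<And>s. s \<in> S \<Longrightarrow> trans_dist D' (h s) = map_pmf h (trans_dist D s)"
    and label: "\<And>s. s \<in> S \<Longrightarrow> state_label D' (h s) = state_label D s"
  shows "s \<in> S \<Longrightarrow> sat \<Phi> D' (h s) \<longleftrightarrow> sat \<Phi> D s"
    and "(\<And>n. \<omega> !! n \<in> S) \<Longrightarrow> path_sat \<phi> D' (smap h \<omega>) \<longleftrightarrow> path_sat \<phi> D \<omega>"
proof (induction \<Phi> and \<phi> arbitrary: s and \<omega>)
  case (Prob c q \<phi>)
  have h: "smap h \<in> path_measure (trans_dist D) s \<rightarrow>\<^sub>M stream_space (count_space UNIV)"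
    by (rule measurable_stream_space2) simp
  have m: "{\<omega>. path_sat \<phi> D' \<omega>} \<in> sets (stream_space (count_space UNIV))"
    using path_sat_measurable by simp
  have "path_measure (trans_dist D') (h s) =
      distr (path_measure (trans_dist D) s) (stream_space (count_space UNIV)) (smap h)"
    by (rule path_measure_lumping[where S=S]) (use closed map Prob.prems in auto)
  then have "measure (path_measure (trans_dist D') (h s)) {\<omega>. path_sat \<phi> D' \<omega>} =
      measure (path_measure (trans_dist D) s) {\<omega>. path_sat \<phi> D' (smap h \<omega>)}"
    by (simp add: measure_distr[OF h m] vimage_def)
  also have "\<dots> = measure (path_measure (trans_dist D) s) {\<omega>. path_sat \<phi> D \<omega>}"
  proof (rule measure_eq_AE)
    have "AE \<omega> in path_measure (trans_dist D) s. \<forall>n. \<omega> !! n \<in> S"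
      by (rule AE_path_measure_closed) (use closed Prob.prems in auto)
    then show "AE \<omega> in path_measure (trans_dist D) s.
        \<omega> \<in> {\<omega>. path_sat \<phi> D' (smap h \<omega>)} \<longleftrightarrow> \<omega> \<in> {\<omega>. path_sat \<phi> D \<omega>}"
      by eventually_elim (use Prob.IH in auto)
    show "{\<omega>. path_sat \<phi> D' (smap h \<omega>)} \<in> sets (path_measure (trans_dist D) s)"
      using measurable_sets[OF h m] by (simp add: vimage_def)
  qed (rule path_sat_measurable)
  finally show ?case by simp
next
  case (Next \<Phi>)
  then show ?case using Next.prems[of 1] by simp
qed (simp_all add: label)

section \<open>Eventuality with positive probability as reachability\<close>

lemma sat_Top [simp]: "sat Top D s"
  by (simp add: Top_def Disj_def Let_def)

text \<open>Positivity of the event propagates backwards along transitions, since a single successor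
  already carries positive mass. Conversely, the reachable states form a closed set, which almost
  every path never leaves.\<close>

lemma sat_eventually_pos_iff:
  fixes D :: "'ap mc"
  shows "sat (Prob Greater 0 (Eventually \<Phi>)) D s \<longleftrightarrow>
     (\<exists>t. (s, t) \<in> {(s, t). t \<in> set_pmf (trans_dist D s)}\<^sup>* \<and> sat \<Phi> D t)"
proof -
  let ?R = "{(s, t). t \<in> set_pmf (trans_dist D s)}"
  let ?M = "path_measure (trans_dist D)" and ?E = "{\<omega>. \<exists>j. sat \<Phi> D (\<omega> !! j)}"
  have m: "?E \<in> sets (stream_space (count_space UNIV))"
    using path_sat_measurable[of "Eventually \<Phi>" D] by (simp add: Eventually_def)
  have pos: "sat (Prob Greater 0 (Eventually \<Phi>)) D s \<longleftrightarrow> emeasure (?M s) ?E \<noteq> 0"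
  proof -
    interpret prob_space "?M s" by (rule prob_space_path_measure)
    show ?thesis by (simp add: Eventually_def emeasure_eq_measure zero_less_measure_iff)
  qed
  have pos_if_reachable: "emeasure (?M s) ?E \<noteq> 0" if "(s, t) \<in> ?R\<^sup>*" "sat \<Phi> D t" for t
    using that(1)
  proof (induction rule: converse_rtrancl_induct)
    case base
    \<comment> \<open>The prepended state \<open>t\<close> itself satisfies \<open>\<Phi>\<close>,
      so index 0 is a witness for every stream.\<close>
    have "{\<omega>. t ## \<omega> \<in> ?E} = UNIV"
      using that(2) by (auto intro: exI[of _ 0])
    moreover have "emeasure (?M u) UNIV = 1" for u
      using prob_space.emeasure_space_1[OF prob_space_path_measure] by simp
    ultimately have "emeasure (?M t) ?E = 1"
      by (subst emeasure_path_measure_step[OF m]) (simp add: measure_pmf.emeasure_space_1)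
    then show ?case by simp
  next
    case (step s u)
    have le: "emeasure (?M v) ?E \<le> emeasure (?M v) {\<omega>. s ## \<omega> \<in> ?E}" for v
    proof (rule emeasure_mono)
      \<comment> \<open>Prepending a state shifts the witnessing index by one.\<close>
      show "?E \<subseteq> {\<omega>. s ## \<omega> \<in> ?E}" by (auto intro: exI[of _ "Suc _"])
      have "(\<lambda>\<omega>. s ## \<omega>) \<in> stream_space (count_space UNIV) \<rightarrow>\<^sub>M stream_space (count_space UNIV)"
        by measurable
      from measurable_sets[OF this m] show "{\<omega>. s ## \<omega> \<in> ?E} \<in> sets (?M v)"
        by (simp add: space_stream_space vimage_def)
    qed
    have "\<not> (AE v in measure_pmf (trans_dist D s). emeasure (?M v) {\<omega>. s ## \<omega> \<in> ?E} = 0)"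
      using step le[of u] by (fastforce simp: AE_measure_pmf_iff)
    then show ?case
      by (subst emeasure_path_measure_step[OF m]) (simp add: nn_integral_0_iff_AE)
  qed
  have null_if_unreachable: "emeasure (?M s) ?E = 0" if none: "\<And>t. (s, t) \<in> ?R\<^sup>* \<Longrightarrow> \<not> sat \<Phi> D t"
  proof -
    have "AE \<omega> in ?M s. \<forall>n. \<omega> !! n \<in> {t. (s, t) \<in> ?R\<^sup>*}"
      by (rule AE_path_measure_closed) (auto intro: rtrancl_into_rtrancl)
    then have "AE \<omega> in ?M s. \<not> (\<exists>j. sat \<Phi> D (\<omega> !! j))"
      by eventually_elim (use none in auto)
    then show ?thesis using m by (subst (asm) AE_iff_measurable[OF _ refl]) auto
  qed
  show ?thesis unfolding pos
  proof (intro iffI)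
    assume "\<exists>t. (s, t) \<in> ?R\<^sup>* \<and> sat \<Phi> D t"
    then obtain t where "(s, t) \<in> ?R\<^sup>*" "sat \<Phi> D t" by (elim exE conjE)
    then show "emeasure (?M s) ?E \<noteq> 0" by (rule pos_if_reachable)
  next
    assume "emeasure (?M s) ?E \<noteq> 0"
    then show "\<exists>t. (s, t) \<in> ?R\<^sup>* \<and> sat \<Phi> D t" by (rule contrapos_np) (rule null_if_unreachable, simp)
  qed
qed


section \<open>Total trees as Markov chains\<close>

text \<open>The values on the support of \<open>q\<close> already sum to 1, which leaves
  \<open>p\<close> no mass elsewhere. For trees this excludes extra children when edge probabilities
  are compared only between given nodes.\<close>

lemma pmf_eqI_support:
  assumes eq: "\<And>x. x \<in> set_pmf q \<Longrightarrow> pmf p x = pmf q x"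
  shows "p = q"
proof -
  have "emeasure (measure_pmf p) (set_pmf q) = (\<integral>\<^sup>+x. pmf p x \<partial>count_space (set_pmf q))"
    by (simp add: nn_integral_pmf)
  also have "\<dots> = (\<integral>\<^sup>+x. pmf q x \<partial>count_space (set_pmf q))"
    using eq by (intro nn_integral_cong) simp
  also have "\<dots> = 1"
    by (simp add: nn_integral_pmf measure_pmf.emeasure_eq_measure measure_pmf.prob_eq_1 AE_measure_pmf)
  finally have "AE x in measure_pmf p. x \<in> set_pmf q"
    by (intro measure_pmf.AE_prob_1) (simp add: measure_pmf.emeasure_eq_measure)
  then have sub: "set_pmf p \<subseteq> set_pmf q" by (auto simp: AE_measure_pmf_iff)
  show ?thesis
  proof (rule pmf_eqI)
    show "pmf p x = pmf q x" for x
      using eq[of x] sub by (cases "x \<in> set_pmf q") (auto simp: set_pmf_iff)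
  qed
qed

section \<open>Distributions and roots of total trees\<close>

lemma edge_prob_nonneg: "edge_prob T \<pi> \<pi>' \<ge> 0"
  by (simp add: edge_prob_def split: option.split)

definition node_pmf :: "'ap pt \<Rightarrow> nat list \<Rightarrow> nat list pmf" where
  "node_pmf T \<pi> = the (node_dist T \<pi>)"

lemma total_pts_prefix:
  assumes "T \<in> total_pts" "\<pi>' \<in> nodes T" "prefix \<pi> \<pi>'" "\<pi> \<noteq> []"
  shows "\<pi> \<in> nodes T"
proof -
  have "\<forall>\<pi> \<pi>'. \<pi>' \<in> nodes T \<union> {[]} \<and> prefix \<pi> \<pi>' \<longrightarrow> \<pi> \<in> nodes T \<union> {[]}"
    using assms(1) unfolding total_pts_def is_pt_def by (elim CollectE conjE)
  with assms(2-) show ?thesis by fastforce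
qed

lemma total_pts_not_Nil: "T \<in> total_pts \<Longrightarrow> [] \<notin> nodes T"
  unfolding total_pts_def is_pt_def by (elim CollectE conjE)

lemma total_pts_label:
  assumes "T \<in> total_pts" "\<pi> \<in> nodes T"
  shows "\<exists>l. node_label T \<pi> = Some l"
proof -
  have "dom (node_label T) = nodes T"
    using assms(1) unfolding total_pts_def is_pt_def by (elim CollectE conjE)
  with assms(2) show ?thesis by auto
qed

text \<open>Totality gives every node a child, and the edge to it has positive probability; an
  undefined distribution would give this edge probability 0.\<close>

lemma total_pts_dist:
  assumes T: "T \<in> total_pts" and \<pi>: "\<pi> \<in> nodes T"
  shows "node_dist T \<pi> = Some (node_pmf T \<pi>)"
    and "edge_prob T \<pi> \<pi>' = pmf (node_pmf T \<pi>) \<pi>'"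
    and "set_pmf (node_pmf T \<pi>) = {\<pi> @ [n] | n. \<pi> @ [n] \<in> nodes T}"
proof -
  obtain \<pi>' where "\<pi>' \<in> nodes T" "strict_prefix \<pi> \<pi>'"
    using T \<pi> by (auto simp: total_pts_def)
  then obtain n where "\<pi> @ [n] \<in> nodes T"
    using total_pts_prefix[OF T, of \<pi>' "\<pi> @ [_]"] by (auto elim!: strict_prefixE')
  moreover have edge: "edge_prob T \<pi> \<pi>' > 0 \<longleftrightarrow> (\<exists>n. \<pi>' = \<pi> @ [n] \<and> \<pi>' \<in> nodes T)" for \<pi>'
    using T \<pi> by (simp add: total_pts_def is_pt_def)
  ultimately have "edge_prob T \<pi> (\<pi> @ [n]) > 0" by simp
  then show 1: "node_dist T \<pi> = Some (node_pmf T \<pi>)"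
    by (auto simp: edge_prob_def node_pmf_def split: option.splits)
  show 2: "edge_prob T \<pi> \<pi>' = pmf (node_pmf T \<pi>) \<pi>'" for \<pi>'
    by (simp add: edge_prob_def 1)
  show "set_pmf (node_pmf T \<pi>) = {\<pi> @ [n] | n. \<pi> @ [n] \<in> nodes T}"
    using edge by (auto simp: 2 pmf_positive_iff)
qed

text \<open>The tree without nodes is total as well, and its \<open>root_of\<close> is unspecified;
  hence the hypothesis \<open>nodes T \<noteq> {}\<close> in later lemmas.\<close>

definition root_of :: "'ap pt \<Rightarrow> nat list" where
  "root_of T = [THE n. [n] \<in> nodes T]"

lemma root_of_eqI: "T \<in> total_pts \<Longrightarrow> [n] \<in> nodes T \<Longrightarrow> root_of T = [n]"
  unfolding root_of_def total_pts_def is_pt_def by (auto intro!: the_equality)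

lemma root_of_prefix:
  assumes T: "T \<in> total_pts" and \<pi>: "\<pi> \<in> nodes T"
  shows "prefix (root_of T) \<pi>"
proof -
  obtain n \<pi>' where "\<pi> = n # \<pi>'" using total_pts_not_Nil[OF T] \<pi> by (cases \<pi>) auto
  moreover from this have "[n] \<in> nodes T" using total_pts_prefix[OF T \<pi>, of "[n]"] by simp
  ultimately show ?thesis using root_of_eqI[OF T] by simp
qed

lemma root_of_in_nodes: "T \<in> total_pts \<Longrightarrow> \<pi> \<in> nodes T \<Longrightarrow> root_of T \<in> nodes T"
  using total_pts_prefix[OF _ _ root_of_prefix] by (simp add: root_of_def)

section \<open>The Markov chain on the nodes of a tree\<close>

definition tree_chain :: "'ap pt \<Rightarrow> 'ap mc" where
  "tree_chain T = \<lparr>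
     states = to_nat ` nodes T,
     trans_dist = (\<lambda>s. map_pmf to_nat (node_pmf T (from_nat s))),
     state_label = (\<lambda>s. the (node_label T (from_nat s))),
     init = to_nat (root_of T)\<rparr>"

lemma tree_chain_simps [simp]:
  "trans_dist (tree_chain T) (to_nat \<pi>) = map_pmf to_nat (node_pmf T \<pi>)"
  "state_label (tree_chain T) (to_nat \<pi>) = the (node_label T \<pi>)"
  "init (tree_chain T) = to_nat (root_of T)"
  "states (tree_chain T) = to_nat ` nodes T"
  by (simp_all add: tree_chain_def)

text \<open>Transitions from numbers that encode no node are arbitrary, so all lumpings of
  \<open>tree_chain T\<close> take the encoded nodes as their closed set \<open>S\<close>.\<close>

lemma tree_chain_closed:
  "T \<in> total_pts \<Longrightarrow> s \<in> to_nat ` nodes T \<Longrightarrow> set_pmf (trans_dist (tree_chain T) s) \<subseteq> to_nat ` nodes T"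
  by (auto simp: total_pts_dist(3))

text \<open>This serves two purposes: \<open>last\<close> as \<open>h\<close> relates an unfolding
  to its chain, and an encoded map of nodes as \<open>h\<close> relates two trees.\<close>

lemma sat_tree_chain_lumping:
  assumes T: "T \<in> total_pts"
    and dist: "\<And>\<pi>. \<pi> \<in> nodes T \<Longrightarrow> trans_dist D (h \<pi>) = map_pmf h (node_pmf T \<pi>)"
    and label: "\<And>\<pi>. \<pi> \<in> nodes T \<Longrightarrow> state_label D (h \<pi>) = the (node_label T \<pi>)"
    and \<pi>: "\<pi> \<in> nodes T"
  shows "sat \<Phi> (tree_chain T) (to_nat \<pi>) \<longleftrightarrow> sat \<Phi> D (h \<pi>)"
proof -
  have "sat \<Phi> D ((h \<circ> from_nat) (to_nat \<pi>)) \<longleftrightarrow> sat \<Phi> (tree_chain T) (to_nat \<pi>)"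
    by (rule sat_lumping(1)[where S="to_nat ` nodes T"])
       (use \<pi> tree_chain_closed[OF T] in \<open>auto simp: dist label pmf.map_comp o_def\<close>)
  then show ?thesis by simp
qed

text \<open>This covers isomorphisms as well as inclusions of suffixes. Although \<open>f\<close>
  need not be onto, \<open>f \<pi>\<close> has no children besides the images of those of
  \<open>\<pi>\<close>: their edge probabilities already sum to 1.\<close>

lemma sat_tree_chain_embedding:
  assumes T1: "T1 \<in> total_pts" and T2: "T2 \<in> total_pts"
    and inj: "inj_on f (nodes T1)" and sub: "f ` nodes T1 \<subseteq> nodes T2"
    and label: "\<And>\<pi>. \<pi> \<in> nodes T1 \<Longrightarrow> node_label T2 (f \<pi>) = node_label T1 \<pi>"
    and edge: "\<And>\<pi> \<pi>'. \<pi> \<in> nodes T1 \<Longrightarrow> \<pi>' \<in> nodes T1 \<Longrightarrow>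
      edge_prob T2 (f \<pi>) (f \<pi>') = edge_prob T1 \<pi> \<pi>'"
    and \<pi>: "\<pi> \<in> nodes T1"
  shows "sat \<Phi> (tree_chain T1) (to_nat \<pi>) \<longleftrightarrow> sat \<Phi> (tree_chain T2) (to_nat (f \<pi>))"
proof (rule sat_tree_chain_lumping[OF T1 _ _ \<pi>])
  fix \<pi> assume \<pi>: "\<pi> \<in> nodes T1"
  have children: "set_pmf (node_pmf T1 \<pi>) \<subseteq> nodes T1"
    using total_pts_dist(3)[OF T1 \<pi>] by auto
  have "node_pmf T2 (f \<pi>) = map_pmf f (node_pmf T1 \<pi>)"
  proof (rule pmf_eqI_support)
    fix x assume "x \<in> set_pmf (map_pmf f (node_pmf T1 \<pi>))"
    then obtain \<pi>' where \<pi>': "\<pi>' \<in> set_pmf (node_pmf T1 \<pi>)" "x = f \<pi>'" by auto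
    have "pmf (map_pmf f (node_pmf T1 \<pi>)) (f \<pi>') = pmf (node_pmf T1 \<pi>) \<pi>'"
      using inj_on_subset[OF inj children] \<pi>'(1) by (rule pmf_map_inj)
    moreover have "pmf (node_pmf T2 (f \<pi>)) (f \<pi>') = pmf (node_pmf T1 \<pi>) \<pi>'"
    proof -
      have "f \<pi> \<in> nodes T2" "\<pi>' \<in> nodes T1" using sub \<pi> \<pi>'(1) children by auto
      with edge[OF \<pi>] show ?thesis
        by (simp add: total_pts_dist(2)[OF T2] total_pts_dist(2)[OF T1 \<pi>])
    qed
    ultimately show "pmf (node_pmf T2 (f \<pi>)) x = pmf (map_pmf f (node_pmf T1 \<pi>)) x"
      using \<pi>' by simp
  qed
  then show "trans_dist (tree_chain T2) (to_nat (f \<pi>)) = map_pmf (\<lambda>\<pi>. to_nat (f \<pi>)) (node_pmf T1 \<pi>)"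
    by (simp add: pmf.map_comp o_def)
  show "state_label (tree_chain T2) (to_nat (f \<pi>)) = the (node_label T1 \<pi>)"
    by (simp add: label[OF \<pi>])
qed

text \<open>Encoded nodes are closed under transitions, and each node is reached from the root
  through its nonempty prefixes.\<close>

lemma tree_chain_reachable:
  assumes T: "T \<in> total_pts" and ne: "nodes T \<noteq> {}"
  shows "(to_nat (root_of T), t) \<in> {(s, t). t \<in> set_pmf (trans_dist (tree_chain T) s)}\<^sup>* \<longleftrightarrow>
    t \<in> to_nat ` nodes T" (is "_ \<in> ?R\<^sup>* \<longleftrightarrow> _")
proof
  show "t \<in> to_nat ` nodes T" if "(to_nat (root_of T), t) \<in> ?R\<^sup>*"
    using that
    by (induction rule: rtrancl_induct) (use ne root_of_in_nodes[OF T] tree_chain_closed[OF T] in blast)+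
  have "(to_nat (root_of T), to_nat \<pi>) \<in> ?R\<^sup>*" if "\<pi> \<in> nodes T" for \<pi>
    using that
  proof (induction \<pi> rule: rev_induct)
    case Nil
    then show ?case using total_pts_not_Nil[OF T] by simp
  next
    case (snoc n \<pi>)
    show ?case
    proof (cases "\<pi> = []")
      case True
      then show ?thesis using snoc root_of_eqI[OF T] by simp
    next
      case False
      then have "\<pi> \<in> nodes T" using total_pts_prefix[OF T snoc.prems] by simp
      moreover from this have "(to_nat \<pi>, to_nat (\<pi> @ [n])) \<in> ?R"
        using snoc.prems by (simp add: total_pts_dist(3)[OF T])
      ultimately show ?thesis using snoc.IH by (meson rtrancl_into_rtrancl)
    qed
  qed
  then show "(to_nat (root_of T), t) \<in> ?R\<^sup>*" if "t \<in> to_nat ` nodes T"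
    using that by blast
qed

lemma tree_chain_eventually_pos_iff:
  assumes "T \<in> total_pts" "nodes T \<noteq> {}"
  shows "mc_sat (tree_chain T) (Prob Greater 0 (Eventually \<Phi>)) \<longleftrightarrow>
    (\<exists>\<pi>\<in>nodes T. sat \<Phi> (tree_chain T) (to_nat \<pi>))"
  unfolding mc_sat_def tree_chain_simps sat_eventually_pos_iff tree_chain_reachable[OF assms] by blast

text \<open>Prepending \<open>u\<close> embeds \<open>T'\<close> into \<open>T\<close>. As the root
  of \<open>T'\<close> is a word of length 1, it lands on a child of \<open>u\<close> and not on
  \<open>u\<close> itself.\<close>

lemma sat_suffix_pt:
  assumes T: "T \<in> total_pts" and T': "T' \<in> total_pts" "suffix_pt T' T" "nodes T' \<noteq> {}"
  obtains \<pi> where "\<pi> \<in> nodes T" "mc_sat (tree_chain T') \<Phi> \<longleftrightarrow> sat \<Phi> (tree_chain T) (to_nat \<pi>)"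
proof -
  obtain u where u: "{u @ \<pi> | \<pi>. \<pi> \<in> nodes T'} \<subseteq> nodes T"
    "\<forall>\<pi>\<in>nodes T'. node_label T' \<pi> = node_label T (u @ \<pi>)"
    "\<forall>\<pi>\<in>nodes T'. \<forall>\<pi>'\<in>nodes T'. edge_prob T' \<pi> \<pi>' = edge_prob T (u @ \<pi>) (u @ \<pi>')"
    using T'(2) unfolding suffix_pt_def by (elim bexE conjE) (rule that)
  have r: "root_of T' \<in> nodes T'" using T' root_of_in_nodes by blast
  have "mc_sat (tree_chain T') \<Phi> \<longleftrightarrow> sat \<Phi> (tree_chain T) (to_nat (u @ root_of T'))"
    unfolding mc_sat_def tree_chain_simps
    by (rule sat_tree_chain_embedding[OF T'(1) T _ _ _ _ r]) (use u in \<open>auto simp: inj_on_def\<close>)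
  moreover have "u @ root_of T' \<in> nodes T" using u(1) r by blast
  ultimately show ?thesis using that by blast
qed

section \<open>Unfoldings and tree chains\<close>

lemma nodes_unfolding_pt [simp]: "nodes (unfolding_pt D) = unfolding_nodes D"
  by (simp add: unfolding_pt_def)

lemma sat_tree_chain_unfolding:
  assumes "\<pi> \<in> unfolding_nodes D"
  shows "sat \<Phi> (tree_chain (unfolding_pt D)) (to_nat \<pi>) \<longleftrightarrow> sat \<Phi> D (last \<pi>)"
  by (rule sat_tree_chain_lumping[OF unfolding_total_pt])
     (use assms in \<open>auto simp: unfolding_pt_def node_pmf_def pmf.map_comp o_def\<close>)

text \<open>An isomorphism is an embedding, so only the roots remain to be matched.\<close>

lemma pt_iso_unfolding_sat:
  assumes T: "T \<in> total_pts" and iso: "pt_iso (unfolding_pt D) T"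
  shows "mc_sat D \<Phi> \<longleftrightarrow> mc_sat (tree_chain T) \<Phi>" and "nodes T \<noteq> {}"
proof -
  let ?U = "unfolding_pt D"
  obtain f where bij: "bij_betw f (nodes ?U) (nodes T)"
    and prefix: "\<And>\<pi> \<pi>'. \<pi> \<in> nodes ?U \<Longrightarrow> \<pi>' \<in> nodes ?U \<Longrightarrow> prefix \<pi> \<pi>' \<longleftrightarrow> prefix (f \<pi>) (f \<pi>')"
    and label: "\<And>\<pi>. \<pi> \<in> nodes ?U \<Longrightarrow> node_label T (f \<pi>) = node_label ?U \<pi>"
    and edge: "\<And>\<pi> \<pi>'. \<pi> \<in> nodes ?U \<Longrightarrow> \<pi>' \<in> nodes ?U \<Longrightarrow>
      edge_prob T (f \<pi>) (f \<pi>') = edge_prob ?U \<pi> \<pi>'"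
    using iso unfolding pt_iso_def by blast
  have r: "[init D] \<in> nodes ?U" by (simp add: unfolding_nodes.root)
  then have fr: "f [init D] \<in> nodes T" using bij by (auto simp: bij_betw_def)
  then show "nodes T \<noteq> {}" by blast
  \<comment> \<open>\<open>\<pi>\<close> is the preimage of the root of \<open>T\<close>. Each of
    \<open>f [init D]\<close> and \<open>root_of T\<close> is a prefix of the other, so they
    coincide.\<close>
  obtain \<pi> where \<pi>: "\<pi> \<in> nodes ?U" "root_of T = f \<pi>"
    using root_of_in_nodes[OF T fr] bij by (auto simp: bij_betw_def)
  have "prefix [init D] \<pi>"
    using root_of_prefix[OF unfolding_total_pt \<pi>(1)] root_of_eqI[OF unfolding_total_pt r] by simp
  then have "f [init D] = root_of T"
    using prefix[OF r \<pi>(1)] root_of_prefix[OF T fr] \<pi>(2) by (simp add: prefix_order.antisym)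
  then show "mc_sat D \<Phi> \<longleftrightarrow> mc_sat (tree_chain T) \<Phi>"
    using sat_tree_chain_embedding[OF unfolding_total_pt T _ _ label edge r] bij
      sat_tree_chain_unfolding[of "[init D]" D] r
    by (simp add: mc_sat_def bij_betw_def)
qed

lemma is_mc_tree_chain: "T \<in> total_pts \<Longrightarrow> nodes T \<noteq> {} \<Longrightarrow> is_mc (tree_chain T)"
  using root_of_in_nodes[of T] tree_chain_closed[of T] by (auto simp: is_mc_def simp del: set_map_pmf)

text \<open>
  A node of the unfolding of \<open>tree_chain T\<close> is the sequence of all prefixes of a node of \<open>T\<close>,
  so its last entry determines it.
\<close>

lemma pt_iso_unfolding_tree_chain:
  assumes T: "T \<in> total_pts" and ne: "nodes T \<noteq> {}"
  shows "pt_iso (unfolding_pt (tree_chain T)) T"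
proof -
  let ?D = "tree_chain T"
  define g :: "nat list \<Rightarrow> nat list" where "g \<pi> = map (\<lambda>i. to_nat (take (Suc i) \<pi>)) [0..<length \<pi>]" for \<pi>
  define f :: "nat list \<Rightarrow> nat list" where "f xs = from_nat (last xs)" for xs
  have g_snoc: "g (\<pi> @ [n]) = g \<pi> @ [to_nat (\<pi> @ [n])]" for \<pi> n
    by (simp add: g_def)
  have g_prefix: "prefix (g \<pi>) (g (\<pi> @ \<pi>'))" for \<pi> \<pi>'
    by (induction \<pi>' rule: rev_induct) (simp_all add: g_snoc flip: append_assoc)
  have fg: "f (g \<pi>) = \<pi>" if "\<pi> \<noteq> []" for \<pi>
    using that by (cases \<pi> rule: rev_cases) (auto simp: g_snoc f_def)
  have len: "length (g \<pi>) = length \<pi>" for \<pi> by (simp add: g_def)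
  have nonempty: "\<pi> \<noteq> []" if "\<pi> \<in> nodes T" for \<pi> using that total_pts_not_Nil[OF T] by auto
  have g_in: "g \<pi> \<in> unfolding_nodes ?D" if "\<pi> \<in> nodes T" for \<pi>
    using that
  proof (induction \<pi> rule: rev_induct)
    case Nil
    then show ?case using nonempty by blast
  next
    case (snoc n \<pi>)
    show ?case
    proof (cases "\<pi> = []")
      case True
      then show ?thesis
        using snoc root_of_eqI[OF T] unfolding_nodes.root[of ?D] by (simp add: g_def)
    next
      case False
      then have \<pi>: "\<pi> \<in> nodes T" using total_pts_prefix[OF T snoc.prems] by simp
      have "last (g \<pi>) = to_nat \<pi>"
        using False by (cases \<pi> rule: rev_cases) (auto simp: g_snoc)
      then have "pmf (trans_dist ?D (last (g \<pi>))) (to_nat (\<pi> @ [n])) > 0"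
        using snoc.prems by (simp add: pmf_positive_iff total_pts_dist(3)[OF T \<pi>])
      then show ?thesis using snoc.IH[OF \<pi>] unfolding_nodes.step by (simp add: g_snoc)
    qed
  qed
  have f_in: "f xs \<in> nodes T \<and> g (f xs) = xs" if "xs \<in> unfolding_nodes ?D" for xs
    using that
  proof (induction rule: unfolding_nodes.induct)
    case root
    then show ?case using ne root_of_in_nodes[OF T] by (auto simp: f_def g_def root_of_def)
  next
    case (step xs t)
    then have 1: "f xs \<in> nodes T" "g (f xs) = xs" by auto
    then have "last xs = to_nat (f xs)"
      using nonempty by (cases "f xs" rule: rev_cases) (auto simp: g_snoc)
    then obtain n where "f xs @ [n] \<in> nodes T" "t = to_nat (f xs @ [n])"
      using step.hyps(2) by (auto simp: pmf_positive_iff total_pts_dist(3)[OF T 1(1)])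
    then show ?case using 1 by (simp add: f_def g_snoc)
  qed
  have bij: "bij_betw f (unfolding_nodes ?D) (nodes T)"
    by (rule bij_betw_byWitness[where f'=g]) (use f_in g_in fg nonempty in auto)
  have prefix: "prefix xs ys \<longleftrightarrow> prefix (f xs) (f ys)"
    if xs: "xs \<in> unfolding_nodes ?D" and ys: "ys \<in> unfolding_nodes ?D" for xs ys
  proof
    assume "prefix (f xs) (f ys)"
    then show "prefix xs ys" using g_prefix f_in[OF xs] f_in[OF ys] by (metis prefixE)
  next
    assume *: "prefix xs ys"
    \<comment> \<open>As \<open>g\<close> preserves lengths and prefixes, cutting \<open>ys\<close>
      at length \<open>k\<close> amounts to cutting \<open>f ys\<close> there.\<close>
    define k where "k = length xs"
    have "xs = take k ys" using * by (auto simp: k_def elim: prefixE)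
    also have "\<dots> = g (take k (f ys))"
    proof -
      have "prefix (g (take k (f ys))) (g (f ys))"
        using g_prefix[of "take k (f ys)" "drop k (f ys)"] by simp
      then obtain b where "ys = g (take k (f ys)) @ b" using f_in[OF ys] by (auto elim: prefixE)
      moreover have "length (g (take k (f ys))) = k"
        using prefix_length_le[OF *] len[of "f ys"] f_in[OF ys] by (simp add: len k_def)
      ultimately show ?thesis by (metis append_eq_conv_conj)
    qed
    finally have "f xs = f (g (take k (f ys)))" by simp
    \<comment> \<open>The inverse law \<open>fg\<close> is available for nonempty words
      only.\<close>
    moreover have "take k (f ys) \<noteq> []"
      using hd_unfolding_nodes[OF xs] f_in[OF ys] nonempty by (auto simp: k_def)
    ultimately show "prefix (f xs) (f ys)" using fg by (simp add: take_is_prefix)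
  qed
  have label: "node_label T (f xs) = node_label (unfolding_pt ?D) xs" if "xs \<in> unfolding_nodes ?D" for xs
  proof -
    have "last xs = to_nat (f xs)"
      using f_in[OF that] nonempty by (cases "f xs" rule: rev_cases) (auto simp: g_snoc dest: sym)
    then show ?thesis
      using that f_in[OF that] total_pts_label[OF T] by (auto simp: unfolding_pt_def)
  qed
  have edge: "edge_prob T (f xs) (f ys) = edge_prob (unfolding_pt ?D) xs ys"
    if xs: "xs \<in> unfolding_nodes ?D" and ys: "ys \<in> unfolding_nodes ?D" for xs ys
  proof (cases "\<exists>t. ys = xs @ [t]")
    case True
    then obtain t where t: "ys = xs @ [t]" by blast
    have l: "last xs = to_nat (f xs)"
      using f_in[OF xs] nonempty by (cases "f xs" rule: rev_cases) (auto simp: g_snoc dest: sym)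
    have "t = to_nat (f ys)"
      using f_in[OF ys] nonempty t by (cases "f ys" rule: rev_cases) (auto simp: g_snoc dest: sym)
    then have "edge_prob (unfolding_pt ?D) xs ys = pmf (map_pmf to_nat (node_pmf T (f xs))) (to_nat (f ys))"
      using edge_prob_unfolding_child[OF xs, of t] l t by simp
    also have "\<dots> = pmf (node_pmf T (f xs)) (f ys)"
      by (rule pmf_map_inj') simp
    finally show ?thesis using total_pts_dist(2)[OF T] f_in[OF xs] by simp
  next
    \<comment> \<open>Both edge probabilities vanish: a positive edge in \<open>T\<close> would make
      \<open>f ys\<close> a child of \<open>f xs\<close>, and \<open>g\<close> would turn this into
      \<open>ys\<close> being a child of \<open>xs\<close>.\<close>
    case False
    then have "\<not> edge_prob (unfolding_pt ?D) xs ys > 0"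
      using edge_prob_unfolding_pos[OF xs] by blast
    moreover have "\<not> edge_prob T (f xs) (f ys) > 0"
    proof
      assume "edge_prob T (f xs) (f ys) > 0"
      then obtain n where "f ys = f xs @ [n]"
        using f_in[OF xs] total_pts_dist(2,3)[OF T, of "f xs"] by (auto simp: pmf_positive_iff)
      then have "ys = xs @ [to_nat (f ys)]"
        using f_in[OF xs] f_in[OF ys] g_snoc by metis
      with False show False by blast
    qed
    ultimately show ?thesis
      using edge_prob_nonneg[of T "f xs" "f ys"] edge_prob_nonneg[of "unfolding_pt ?D" xs ys] by linarith
  qed
  show ?thesis
    unfolding pt_iso_def nodes_unfolding_pt
    using bij prefix label edge by blast
qed

section \<open>Membership in the property of a formula, and subtrees\<close>

lemma property_of_iff:
  "T \<in> property_of \<Phi> \<longleftrightarrow> T \<in> total_pts \<and> nodes T \<noteq> {} \<and> mc_sat (tree_chain T) \<Phi>"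
  \<comment> \<open>Any chain whose unfolding is isomorphic to \<open>T\<close> agrees with
    \<open>tree_chain T\<close> on \<open>\<Phi>\<close>; conversely, \<open>tree_chain T\<close> is
    itself such a chain.\<close>
  unfolding property_of_def
  using pt_iso_unfolding_sat is_mc_tree_chain pt_iso_unfolding_tree_chain by blast

text \<open>The suffix is cut off at the parent \<open>u\<close>, so that \<open>u @ [n]\<close>
  becomes its root \<open>[n]\<close>. The root of \<open>T\<close> has no parent node, which is why
  \<open>u\<close> must be nonempty.\<close>

lemma subtree_exists:
  fixes T :: "'ap pt"
  assumes T: "T \<in> total_pts" and v: "u @ [n] \<in> nodes T" and "u \<noteq> []"
  obtains T' where "T' \<in> total_pts" "suffix_pt T' T" "nodes T' \<noteq> {}"
    "mc_sat (tree_chain T') \<Phi> \<longleftrightarrow> sat \<Phi> (tree_chain T) (to_nat (u @ [n]))"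
proof -
  \<comment> \<open>The condition \<open>prefix [n] w\<close> discards the siblings of
    \<open>u @ [n]\<close>, which would be further roots.\<close>
  define N where "N = {w. u @ w \<in> nodes T \<and> prefix [n] w}"
  define T' :: "'ap pt" where "T' = \<lparr>nodes = N,
    node_label = (\<lambda>w. if w \<in> N then node_label T (u @ w) else None),
    node_dist = (\<lambda>w. if w \<in> N then Some (map_pmf (drop (length u)) (node_pmf T (u @ w))) else None)\<rparr>"
  have nodes: "nodes T' = N" by (simp add: T'_def)
  have edge: "edge_prob T' w w' = edge_prob T (u @ w) (u @ w')" if w: "w \<in> N" for w w'
  proof -
    have uw: "u @ w \<in> nodes T" using w by (simp add: N_def)
    \<comment> \<open>All children of \<open>u @ w\<close> extend \<open>u\<close>, so prepending
      \<open>u\<close> undoes the \<open>drop\<close>.\<close>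
    have "map_pmf ((@) u) (map_pmf (drop (length u)) (node_pmf T (u @ w))) = map_pmf id (node_pmf T (u @ w))"
      unfolding pmf.map_comp by (rule map_pmf_cong) (auto simp: total_pts_dist(3)[OF T uw])
    then have "pmf (node_pmf T (u @ w)) (u @ w') =
        pmf (map_pmf ((@) u) (map_pmf (drop (length u)) (node_pmf T (u @ w)))) (u @ w')"
      by simp
    also have "\<dots> = pmf (map_pmf (drop (length u)) (node_pmf T (u @ w))) w'"
      by (rule pmf_map_inj') (simp add: inj_def)
    finally show ?thesis
      using w total_pts_dist(2)[OF T uw] by (simp add: edge_prob_def T'_def)
  qed
  have step: "edge_prob T \<pi> \<pi>' > 0 \<longleftrightarrow> (\<exists>n. \<pi>' = \<pi> @ [n] \<and> \<pi>' \<in> nodes T)" if "\<pi> \<in> nodes T" for \<pi> \<pi>'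
    using T that by (simp add: total_pts_def is_pt_def)
  have "is_pt T'"
    unfolding is_pt_def nodes
  proof (intro conjI allI impI ballI)
    show "[] \<notin> N" by (simp add: N_def)
    show "\<pi> \<in> N \<union> {[]}" if "\<pi>' \<in> N \<union> {[]} \<and> prefix \<pi> \<pi>'" for \<pi> \<pi>'
      using that total_pts_prefix[OF T, of "u @ \<pi>'" "u @ \<pi>"] \<open>u \<noteq> []\<close>
      by (cases \<pi>; cases \<pi>') (auto simp: N_def)
    show "m = k" if "[m] \<in> N \<and> [k] \<in> N" for m k using that by (simp add: N_def)
    show "dom (node_label T') = N"
      using total_pts_label[OF T] by (auto simp: T'_def dom_def N_def)
    show "dom (node_dist T') \<subseteq> N" by (auto simp: T'_def split: if_splits)
    show "edge_prob T' w w' > 0 \<longleftrightarrow> (\<exists>m. w' = w @ [m] \<and> w' \<in> N)" if "w \<in> N" for w w'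
      using that step[of "u @ w" "u @ w'"] by (auto simp: edge N_def prefix_Cons)
  qed
  moreover have "\<exists>w'\<in>N. strict_prefix w w'" if w: "w \<in> N" for w
  proof -
    have "u @ w \<in> nodes T" using w by (simp add: N_def)
    then obtain m where "u @ w @ [m] \<in> nodes T"
      using total_pts_dist(3)[OF T, of "u @ w"] set_pmf_not_empty[of "node_pmf T (u @ w)"] by auto
    then have "w @ [m] \<in> N" using w by (auto simp: N_def prefix_Cons)
    then show ?thesis by (intro bexI[of _ "w @ [m]"]) (auto simp: strict_prefix_def)
  qed
  ultimately have T': "T' \<in> total_pts" by (simp add: total_pts_def nodes)
  have r: "[n] \<in> N" using v by (simp add: N_def)
  have u: "u \<in> nodes T" using total_pts_prefix[OF T v] \<open>u \<noteq> []\<close> by simp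
  have label: "node_label T' w = node_label T (u @ w)" if "w \<in> N" for w
    using that by (simp add: T'_def)
  have "suffix_pt T' T"
    unfolding suffix_pt_def nodes using u edge label by (intro bexI[of _ u]) (auto simp: N_def)
  moreover have "mc_sat (tree_chain T') \<Phi> \<longleftrightarrow> sat \<Phi> (tree_chain T) (to_nat (u @ [n]))"
    unfolding mc_sat_def tree_chain_simps root_of_eqI[OF T' r[folded nodes]]
    by (rule sat_tree_chain_embedding[OF T' T])
       (use r in \<open>auto simp: nodes edge label\<close>, auto simp: N_def inj_on_def)
  ultimately show ?thesis using that T' r nodes by blast
qed

theorem theorem11:
  fixes \<Phi> :: "('ap::finite) state_formula"
  assumes "wf_state \<Phi>"
  shows "pctl_absolute_liveness \<Phi> \<longleftrightarrow>
    \<not> pctl_equiv \<Phi> Bot \<and> pctl_equiv \<Phi> (Prob Greater 0 (Eventually \<Phi>))"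
proof -
  let ?P = "property_of \<Phi>" and ?E = "property_of (Prob Greater 0 (Eventually \<Phi>))"
  \<comment> \<open>Thus \<open>\<not> pctl_equiv \<Phi> Bot\<close> expresses exactly the
    nonemptiness required of an absolute liveness property.\<close>
  have Bot: "property_of Bot = ({} :: 'ap pt set)"
    by (auto simp: property_of_iff mc_sat_def Bot_def)
  have E: "T \<in> ?E \<longleftrightarrow> T \<in> total_pts \<and> (\<exists>\<pi>\<in>nodes T. sat \<Phi> (tree_chain T) (to_nat \<pi>))" for T
    using tree_chain_eventually_pos_iff by (auto simp: property_of_iff)
  have sub: "?P \<subseteq> ?E"
  proof
    fix T assume "T \<in> ?P"
    then have "T \<in> total_pts" "nodes T \<noteq> {}" "sat \<Phi> (tree_chain T) (to_nat (root_of T))"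
      by (simp_all add: property_of_iff mc_sat_def)
    then show "T \<in> ?E" unfolding E using root_of_in_nodes by blast
  qed
  \<comment> \<open>A node satisfying \<open>\<Phi>\<close> is either the root, which settles the
    claim, or the root of a suffix in \<open>?P\<close>, from which absolute liveness passes to
    \<open>T\<close>.\<close>
  have "?E \<subseteq> ?P" if live: "absolute_liveness ?P"
  proof
    fix T assume "T \<in> ?E"
    then obtain \<pi> where T: "T \<in> total_pts" and \<pi>: "\<pi> \<in> nodes T" "sat \<Phi> (tree_chain T) (to_nat \<pi>)"
      by (auto simp: E)
    obtain u n where un: "\<pi> = u @ [n]"
      using total_pts_not_Nil[OF T] \<pi>(1) by (cases \<pi> rule: rev_cases) auto
    show "T \<in> ?P"
    proof (cases "u = []")
      case True
      then show ?thesis using T \<pi> un root_of_eqI[OF T, of n] by (auto simp: property_of_iff mc_sat_def)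
    next
      case False
      obtain T' where T': "T' \<in> total_pts" "suffix_pt T' T" "nodes T' \<noteq> {}"
        "mc_sat (tree_chain T') \<Phi> \<longleftrightarrow> sat \<Phi> (tree_chain T) (to_nat (u @ [n]))"
        using subtree_exists[OF T \<pi>(1)[unfolded un] False] .
      have "T' \<in> ?P" using T' \<pi>(2) by (simp add: property_of_iff un)
      with T' T live show ?thesis unfolding absolute_liveness_def by blast
    qed
  qed
  \<comment> \<open>A suffix in \<open>?P\<close> supplies a node of \<open>T\<close> satisfying
    \<open>\<Phi>\<close>, which puts \<open>T\<close> into \<open>?E\<close>.\<close>
  moreover have "absolute_liveness ?P" if "?P \<noteq> {}" "?P = ?E"
    unfolding absolute_liveness_def
  proof (intro conjI ballI impI, fact)
    fix T T' :: "'ap pt" assume T: "T \<in> total_pts" "T' \<in> total_pts" "T' \<in> ?P \<and> suffix_pt T' T"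
    then have ne: "nodes T' \<noteq> {}" and sat: "mc_sat (tree_chain T') \<Phi>" and suffix: "suffix_pt T' T"
      by (simp_all add: property_of_iff)
    obtain \<pi> where "\<pi> \<in> nodes T"
      "mc_sat (tree_chain T') \<Phi> \<longleftrightarrow> sat \<Phi> (tree_chain T) (to_nat \<pi>)"
      using sat_suffix_pt[OF T(1,2) suffix ne] .
    with sat have "T \<in> ?E" using T(1) by (auto simp: E)
    then show "T \<in> ?P" using \<open>?P = ?E\<close> by simp
  qed
  moreover have "?P \<noteq> {}" if "absolute_liveness ?P" using that by (simp add: absolute_liveness_def)
  ultimately show ?thesis
    using sub unfolding pctl_absolute_liveness_def pctl_equiv_def Bot by blast
qed

end
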